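(* Let $U\subset\mathbb{R}^V$ be a linear space of graph signals. Then the following are equivalent: (a) $U$ is a graph shift-invariant space; (b) $U$ is the range space $R(\mathbf{H})=\{\mathbf{H}\mathbf{x} : \mathbf{x}\in\mathbb{R}^V\}$ of some shift-invariant filter $\mathbf{H}$; (c) $U$ is the kernel space $K(\mathbf{G})=\{\mathbf{x}\in\mathbb{R}^V : \mathbf{G}\mathbf{x}=\mathbf{0}\}$ of some shift-invariant filter $\mathbf{G}$.
   Context: Let $\mathcal{G}=(V,E,\mathbf{W})$ be a finite, simple, undirected graph with $N\ge 2$ vertices. A graph signal is a vector in $\mathbb{R}^V$; a graph filter is a real matrix in $\mathbb{R}^{V\times V}$. A graph shift is a matrix $\mathbf{S}=[s(i,j)]_{i,j\in V}$ with $s(i,j)=0$ unless $i=j$ or $(i,j)\in E$. Standing assumption: $\mathbf{S}_1,\ldots,\mathbf{S}_d$ are graph shifts that are real-valued, symmetric and pairwise commuting. A graph shift-invariant space is a linear space $U$ of graph signals such that $\mathbf{S}_l\mathbf{x}\in U$ for all $1\le l\le d$ and $\mathbf{x}\in U$. A shift-invariant filter is a graph filter $\mathbf{H}$ with $\mathbf{H}\mathbf{S}_l=\mathbf{S}_l\mathbf{H}$ for all $1\le l\le d$. *)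

theory Defs
  imports "HOL-Analysis.Analysis"
begin

text \<open>The vertex set is the finite type \<^typ>\<open>'v\<close>, so graph signals have type
  \<open>real ^ 'v\<close> and graph filters have type \<open>real ^ 'v ^ 'v\<close>, with \<open>A $ i $ j\<close> the entry
  in row \<open>i\<close> and column \<open>j\<close>. An undirected edge is represented by its two orientations.\<close>

record ('v::finite) weighted_graph =
  edges :: "('v \<times> 'v) set"
  weights :: "real ^ 'v ^ 'v"

text \<open>The weight matrix is part of the graph, but it is arbitrary: the notions below depend
  only on the edges.\<close>

definition simple_undirected :: "'v::finite weighted_graph \<Rightarrow> bool" where
  "simple_undirected G \<longleftrightarrow> irrefl (edges G) \<and> sym (edges G)"

definition graph_shift :: "'v::finite weighted_graph \<Rightarrow> real ^ 'v ^ 'v \<Rightarrow> bool" where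
  "graph_shift G A \<longleftrightarrow> (\<forall>i j. i \<noteq> j \<and> (i, j) \<notin> edges G \<longrightarrow> A $ i $ j = 0)"

text \<open>A family \<open>S\<^sub>1, \<dots>, S\<^sub>d\<close> is a function on \<^typ>\<open>nat\<close> of which only the values at
  \<open>1, \<dots>, d\<close> matter.\<close>

definition commuting_symmetric_shifts ::
  "'v::finite weighted_graph \<Rightarrow> nat \<Rightarrow> (nat \<Rightarrow> real ^ 'v ^ 'v) \<Rightarrow> bool" where
  "commuting_symmetric_shifts G d S \<longleftrightarrow>
     (\<forall>l\<in>{1..d}. graph_shift G (S l) \<and> transpose (S l) = S l) \<and>
     (\<forall>k\<in>{1..d}. \<forall>l\<in>{1..d}. S k ** S l = S l ** S k)"

definition shift_invariant_space ::
  "nat \<Rightarrow> (nat \<Rightarrow> real ^ 'v ^ 'v) \<Rightarrow> (real ^ 'v::finite) set \<Rightarrow> bool" where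
  "shift_invariant_space d S U \<longleftrightarrow>
     subspace U \<and> (\<forall>l\<in>{1..d}. \<forall>x\<in>U. S l *v x \<in> U)"

definition shift_invariant_filter ::
  "nat \<Rightarrow> (nat \<Rightarrow> real ^ 'v ^ 'v) \<Rightarrow> real ^ 'v ^ 'v::finite \<Rightarrow> bool" where
  "shift_invariant_filter d S H \<longleftrightarrow> (\<forall>l\<in>{1..d}. H ** S l = S l ** H)"

definition range_space :: "real ^ 'v ^ 'v \<Rightarrow> (real ^ 'v::finite) set" where
  "range_space H = {H *v x | x. True}"

definition kernel_space :: "real ^ 'v ^ 'v \<Rightarrow> (real ^ 'v::finite) set" where
  "kernel_space H = {x. H *v x = 0}"

end

theory Submission
  imports Defs
begin

text \<open>If \<open>U\<close> is invariant under symmetric matrices, so is its orthogonal complement. Hence the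
  orthogonal projection \<open>P\<close> onto \<open>U\<close> commutes with all shifts, and \<open>U\<close> is the range of \<open>P\<close> and the
  kernel of \<open>I - P\<close>. Commutation of a filter with the shifts conversely makes its range and its
  kernel invariant.\<close>

text \<open>The difference of two candidates lies in \<open>U\<close> and in its orthogonal
  complement, so it is orthogonal to itself. This uniqueness is what identifies projections below:
  linearity, commutation and the fixed points all follow from it.\<close>

lemma orthogonal_decomposition_unique:
  assumes "subspace U" and "u \<in> U" "v \<in> U" "x - u \<in> U\<^sup>\<bottom>" "x - v \<in> U\<^sup>\<bottom>"
  shows "u = v"
proof -
  have "u - v \<in> U" "u - v \<in> U\<^sup>\<bottom>"
    using assms subspace_diff[of U u v]
      subspace_diff[OF subspace_orthogonal_comp, of "x - v" U "x - u"] by simp_all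
  then have "orthogonal (u - v) (u - v)"
    by (simp add: orthogonal_comp_def)
  then show ?thesis
    by (simp add: orthogonal_self)
qed

text \<open>A component in \<open>U\<close> is chosen separately for each vector. Sums and multiples
  of decompositions are again decompositions, so uniqueness forces the choice function to be linear
  and hence given by a matrix.\<close>

lemma orthogonal_projection_matrix_exists:
  fixes U :: "(real ^ 'n) set"
  assumes "subspace U"
  obtains P :: "real ^ 'n ^ 'n" where "\<And>x. P *v x \<in> U" "\<And>x. x - P *v x \<in> U\<^sup>\<bottom>"
proof -
  have "\<exists>u. u \<in> U \<and> x - u \<in> U\<^sup>\<bottom>" for x
  proof -
    have "x \<in> U + U\<^sup>\<bottom>"
      using subspace_sum_orthogonal_comp[OF assms] by simp
    then obtain u w where "x = u + w" "u \<in> U" "w \<in> U\<^sup>\<bottom>"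
      by (rule set_plus_elim)
    then show ?thesis by auto
  qed
  then obtain f where f: "\<And>x. f x \<in> U" "\<And>x. x - f x \<in> U\<^sup>\<bottom>"
    by metis
  have "linear f"
  proof (rule linearI)
    fix x y
    have "x + y - (f x + f y) \<in> U\<^sup>\<bottom>"
      using subspace_add[OF subspace_orthogonal_comp f(2) f(2), of x y]
      by (simp add: algebra_simps)
    then show "f (x + y) = f x + f y"
      using orthogonal_decomposition_unique[OF assms] f assms by (meson subspace_add)
  next
    fix c x
    have "c *\<^sub>R x - c *\<^sub>R f x \<in> U\<^sup>\<bottom>"
      using subspace_scale[OF subspace_orthogonal_comp f(2), of c x]
      by (simp add: algebra_simps)
    then show "f (c *\<^sub>R x) = c *\<^sub>R f x"
      using orthogonal_decomposition_unique[OF assms] f assms by (meson subspace_scale)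
  qed
  then have "matrix f *v x = f x" for x
    by simp
  with f that[of "matrix f"] show thesis by simp
qed

text \<open>Symmetry moves \<open>A\<close> to the other factor of the inner product, where it acts
  on a vector of \<open>U\<close> and stays in \<open>U\<close>.\<close>

lemma symmetric_invariant_orthogonal_comp:
  fixes A :: "real ^ 'n ^ 'n"
  assumes "transpose A = A" and "\<And>x. x \<in> U \<Longrightarrow> A *v x \<in> U" and "w \<in> U\<^sup>\<bottom>"
  shows "A *v w \<in> U\<^sup>\<bottom>"
proof -
  have "y \<bullet> (A *v w) = (A *v y) \<bullet> w" for y
    by (metis assms(1) dot_lmul_matrix transpose_matrix_vector)
  then show ?thesis
    using assms(2,3) by (simp add: orthogonal_comp_def orthogonal_def)
qed

text \<open>Both summands of x = Px + (x - Px) stay in their spaces under \<open>A\<close>, so the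
  image is the decomposition of Ax. By uniqueness its component A(Px) in \<open>U\<close> equals
  P(Ax).\<close>

lemma orthogonal_projection_commute:
  fixes A P :: "real ^ 'n ^ 'n"
  assumes "subspace U" and P: "\<And>x. P *v x \<in> U" "\<And>x. x - P *v x \<in> U\<^sup>\<bottom>"
    and A: "transpose A = A" "\<And>x. x \<in> U \<Longrightarrow> A *v x \<in> U"
  shows "P ** A = A ** P"
proof -
  have "P *v (A *v x) = A *v (P *v x)" for x
  proof (rule orthogonal_decomposition_unique[OF assms(1)])
    show "A *v x - A *v (P *v x) \<in> U\<^sup>\<bottom>"
      using symmetric_invariant_orthogonal_comp[OF A P(2), of x]
      by (simp add: matrix_vector_mult_diff_distrib)
  qed (use P A in auto)
  then show ?thesis
    by (simp add: matrix_eq matrix_vector_mul_assoc[symmetric])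
qed

lemma shift_invariant_filter_apply:
  assumes "shift_invariant_filter d S H" and "l \<in> {1..d}"
  shows "S l *v (H *v x) = H *v (S l *v x)"
  using assms by (simp add: shift_invariant_filter_def matrix_vector_mul_assoc)

lemma shift_invariant_range_space:
  assumes "shift_invariant_filter d S H"
  shows "shift_invariant_space d S (range_space H)"
proof -
  have "range_space H = range ((*v) H)"
    by (auto simp: range_space_def)
  then have "subspace (range_space H)"
    by (simp add: linear_subspace_image)
  then show ?thesis
    using shift_invariant_filter_apply[OF assms]
    by (auto simp: shift_invariant_space_def range_space_def)
qed

lemma shift_invariant_kernel_space:
  assumes "shift_invariant_filter d S K"
  shows "shift_invariant_space d S (kernel_space K)"
proof -
  have "subspace (kernel_space K)"
    by (simp add: kernel_space_def linear_subspace_kernel)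
  then show ?thesis
    using shift_invariant_filter_apply[OF assms, symmetric]
    by (auto simp: shift_invariant_space_def kernel_space_def)
qed

lemma shift_invariant_projection_exists:
  fixes U :: "(real ^ 'v::finite) set"
  assumes "commuting_symmetric_shifts G d S" and "shift_invariant_space d S U"
  obtains P where "shift_invariant_filter d S P"
    and "U = range_space P" and "U = kernel_space (mat 1 - P)"
proof -
  have U: "subspace U"
    using assms(2) by (simp add: shift_invariant_space_def)
  obtain P :: "real ^ 'v ^ 'v" where P: "\<And>x. P *v x \<in> U" "\<And>x. x - P *v x \<in> U\<^sup>\<bottom>"
    using orthogonal_projection_matrix_exists[OF U] by metis
  \<comment> \<open>For x in \<open>U\<close>, the decomposition x = x + 0 competes with the one
    given by \<open>P\<close>.\<close>
  have fixed: "P *v x = x" if "x \<in> U" for x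
    using orthogonal_decomposition_unique[OF U P(1) that P(2)]
    by (simp add: subspace_0 subspace_orthogonal_comp)
  have "P ** S l = S l ** P" if "l \<in> {1..d}" for l
    using that assms
    by (intro orthogonal_projection_commute[OF U P])
      (auto simp: commuting_symmetric_shifts_def shift_invariant_space_def)
  then have "shift_invariant_filter d S P"
    by (simp add: shift_invariant_filter_def)
  moreover have "U = range_space P"
    unfolding range_space_def using P(1) fixed by (auto intro: sym)
  \<comment> \<open>Membership in this kernel means Px = x, which puts x in \<open>U\<close> because
    every Px lies there; conversely \<open>P\<close> fixes \<open>U\<close>.\<close>
  moreover have "U = kernel_space (mat 1 - P)"
    using fixed P(1)
    by (auto simp: kernel_space_def matrix_vector_mult_diff_rdistrib) metis
  ultimately show thesis by (rule that)
qed

text \<open>Applied to the projection \<open>P\<close>, this makes \<open>mat 1 - P\<close> an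
  admissible witness for the kernel characterization.\<close>

lemma shift_invariant_filter_complement:
  fixes H :: "real ^ 'v::finite ^ 'v"
  assumes "shift_invariant_filter d S H"
  shows "shift_invariant_filter d S (mat 1 - H)"
  using shift_invariant_filter_apply[OF assms]
  by (simp add: shift_invariant_filter_def matrix_eq matrix_vector_mul_assoc[symmetric]
      matrix_vector_mult_diff_rdistrib matrix_vector_mult_diff_distrib)

theorem theorem3p8:
  fixes G :: "'v::finite weighted_graph"
    and d :: nat
    and S :: "nat \<Rightarrow> real ^ 'v ^ 'v"
    and U :: "(real ^ 'v) set"
  assumes "CARD('v) \<ge> 2"
    and "simple_undirected G"
    and "commuting_symmetric_shifts G d S"
    and "subspace U"
  shows "(shift_invariant_space d S U \<longleftrightarrow>
            (\<exists>H. shift_invariant_filter d S H \<and> U = range_space H)) \<and>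
         (shift_invariant_space d S U \<longleftrightarrow>
            (\<exists>K. shift_invariant_filter d S K \<and> U = kernel_space K))"
  using assms(3) shift_invariant_range_space shift_invariant_kernel_space
    shift_invariant_projection_exists shift_invariant_filter_complement
  by metis

end
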